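(* Let $n\ge 3$ be an integer and let $C_n$ denote a cycle on $n$ vertices. Let $X_{C_n}$ be the number of vertices with non-zero in-degree after a random orientation on the edges of $C_n$. Then \[ H(X_{C_n}) \ge \frac{1}{2}\log(n) + \frac{1}{2}\log(\pi e) - \frac{3}{2} - \frac{1}{2\ln(2)(n-1)}. \]
   Context: Throughout, $\log$ denotes the logarithm with base $2$ and $\ln$ the natural logarithm. The Shannon entropy of a random variable $X$ taking values in a finite set $S$ is $H(X) = -\sum_{s\in S}\mathbb{P}[X=s]\cdot\log\mathbb{P}[X=s]$, with the convention $0\log 0=0$. A random orientation on the edges of a graph means that each edge is oriented towards one of its two endpoints, each with probability $1/2$, independently of all other edges. The in-degree of a vertex $v$ is the number of edges that are oriented towards $v$. *)

theory Defs
  imports "HOL-Probability.Probability" "HOL-Probability.Product_PMF"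
begin

text \<open>Graphs are given by a vertex set \<open>V\<close> and a set \<open>E\<close> of two-element subsets of \<open>V\<close>.\<close>

definition is_cycle_graph :: "nat \<Rightarrow> 'a set \<Rightarrow> 'a set set \<Rightarrow> bool" where
  "is_cycle_graph n V E \<longleftrightarrow> n \<ge> 3 \<and>
     (\<exists>v. bij_betw v {..<n} V \<and> E = {{v i, v ((i + 1) mod n)} | i. i < n})"

text \<open>
  An orientation maps each edge to the endpoint it points to. Under the product distribution the
  edges choose independently, and \<open>pmf_of_set e\<close> gives each endpoint of \<open>e\<close> probability 1/2.
  The value \<open>undefined\<close> is only taken outside \<open>E\<close>.
\<close>

definition random_orientation :: "'a set set \<Rightarrow> ('a set \<Rightarrow> 'a) pmf" where
  "random_orientation E = Pi_pmf E undefined pmf_of_set"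

definition in_degree :: "'a set set \<Rightarrow> ('a set \<Rightarrow> 'a) \<Rightarrow> 'a \<Rightarrow> nat" where
  "in_degree E \<omega> v = card {e \<in> E. \<omega> e = v}"

definition num_nonzero_in_degree :: "'a set \<Rightarrow> 'a set set \<Rightarrow> ('a set \<Rightarrow> 'a) \<Rightarrow> nat" where
  "num_nonzero_in_degree V E \<omega> = card {v \<in> V. in_degree E \<omega> v \<noteq> 0}"

text \<open>
  Shannon entropy in bits is the library's entropy with respect to counting measure; the lemma below
  gives the usual formula, for which \<open>0 * log 2 0 = 0\<close> holds automatically.
\<close>

abbreviation shannon_entropy :: "'a pmf \<Rightarrow> 'b set \<Rightarrow> ('a \<Rightarrow> 'b) \<Rightarrow> real" where
  "shannon_entropy p S X \<equiv> prob_space.entropy (measure_pmf p) 2 (count_space S) X"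

lemma shannon_entropy_eq_sum:
  assumes "finite S" and XS: "range X \<subseteq> S"
  shows "shannon_entropy p S X =
    - (\<Sum>s\<in>S. measure_pmf.prob p {\<omega>. X \<omega> = s} * log 2 (measure_pmf.prob p {\<omega>. X \<omega> = s}))"
proof -
  interpret information_space "measure_pmf p" 2
    by unfold_locales simp
  let ?P = "\<lambda>s. measure_pmf.prob p {\<omega>. X \<omega> = s}"
  have fin: "finite (range X)"
    using assms finite_subset by blast
  have sf: "simple_function (measure_pmf p) X"
    using fin by (auto simp: simple_function_def)
  have "distributed (measure_pmf p) (count_space S) X
      (\<lambda>s. ennreal (if s \<in> X ` space (measure_pmf p) then ?P s else 0))"
    by (rule measure_pmf.distributed_simple_function_superset[OF sf])
      (use assms in \<open>auto intro!: arg_cong[where f = "measure_pmf.prob p"]\<close>)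
  moreover have "(if s \<in> X ` space (measure_pmf p) then ?P s else 0) = ?P s" for s
  proof (cases "s \<in> range X")
    case False
    then have "{\<omega>. X \<omega> = s} = {}" by auto
    then show ?thesis by simp
  qed simp
  ultimately have "distributed (measure_pmf p) (count_space S) X (\<lambda>s. ennreal (?P s))"
    by simp
  from entropy_distr[OF this] show ?thesis
    using \<open>finite S\<close> by (simp add: lebesgue_integral_count_space_finite)
qed

end

theory Submission
  imports Defs "HOL-Real_Asymp.Real_Asymp"
begin

text \<open>
  Encode an orientation as a cyclic binary word (is edge \<open>i\<close> directed forwards?). The vertices of
  in-degree \<open>0\<close> are the ascents of this word, and a cyclic word has as many ascents as descents.
  A word is determined by its first letter and its set of changes, an arbitrary set of even size, so
  the number of missed vertices is \<open>k\<close> with probability \<open>(n choose 2 * k) / 2 ^ (n - 1)\<close>.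

  The binomial probabilities satisfy a pointwise Gaussian upper bound with exponent
  \<open>- 2 * (j - n/2)\<^sup>2 / (n + 1)\<close>: the ratio of consecutive coefficients is \<open>(1 - u) / (1 + u) \<le> exp (- 2 * u)\<close>,
  and the central coefficient is bounded by Wallis' product. Inserting the bound into the logarithm
  reduces the entropy estimate to the second moment of the binomial distribution on even numbers, which
  for \<open>n \<ge> 3\<close> is that of the full binomial distribution.
\<close>

section \<open>Central binomial coefficients and Wallis' product\<close>

lemma central_binomial_Suc:
  "Suc m * ((2 * Suc m) choose Suc m) = 2 * (2 * m + 1) * ((2 * m) choose m)"
proof -
  have "Suc m * ((2 * Suc m) choose Suc m) = 2 * (Suc m * (Suc (2 * m) choose m))"
    using Suc_times_binomial[of m "Suc (2 * m)"] by (simp add: algebra_simps)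
  also have "Suc (2 * m) choose m = Suc (2 * m) choose Suc m"
    using binomial_symmetric[of m "Suc (2 * m)"] by (simp add: Suc_diff_le)
  also have "Suc m * \<dots> = (2 * m + 1) * ((2 * m) choose m)"
    using Suc_times_binomial[of m "2 * m"] by simp
  finally show ?thesis by simp
qed

text \<open>This is the probability of exactly \<open>m\<close> heads in \<open>2 * m\<close> fair
  coin tosses.\<close>

definition central_prob :: "nat \<Rightarrow> real" where
  "central_prob m = real ((2 * m) choose m) / 4 ^ m"

lemma central_prob_Suc:
  "central_prob (Suc m) = central_prob m * (2 * real m + 1) / (2 * real m + 2)"
proof -
  have "real (Suc m) * real ((2 * Suc m) choose Suc m)
      = 2 * (2 * real m + 1) * real ((2 * m) choose m)"
    using arg_cong[OF central_binomial_Suc[of m], of real]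
    unfolding of_nat_mult of_nat_add of_nat_numeral of_nat_1 .
  then have *: "real ((2 * Suc m) choose Suc m)
      = 2 * (2 * real m + 1) * real ((2 * m) choose m) / real (Suc m)"
    by (simp add: eq_divide_eq mult.commute del: binomial_Suc_Suc of_nat_Suc)
  show ?thesis
    unfolding central_prob_def * by (simp add: divide_simps del: binomial_Suc_Suc) (simp add: algebra_simps)
qed

lemma central_prob_pos: "central_prob m > 0"
  by (simp add: central_prob_def)

text \<open>The factor at \<open>Suc m\<close> is \<open>(2m+2)^2 / ((2m+1)(2m+3))\<close>, the
  inverse square of the ratio in \<open>central_prob_Suc\<close> up to \<open>(2m+1)/(2m+3)\<close>,
  which telescopes. The limit in \<open>wallis\<close> thus becomes a limit for
  \<open>central_prob\<close>.\<close>

lemma wallis_product_eq: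
  "(\<Prod>k=1..m. (4 * real k ^ 2) / (4 * real k ^ 2 - 1)) = 1 / ((2 * real m + 1) * central_prob m ^ 2)"
proof (induction m)
  case 0
  show ?case by (simp add: central_prob_def)
next
  case (Suc m)
  have *: "4 * real (Suc m) ^ 2 - 1 = (2 * real m + 1) * (2 * real m + 3)"
    by (simp add: algebra_simps power2_eq_square)
  have "(\<Prod>k=1..Suc m. (4 * real k ^ 2) / (4 * real k ^ 2 - 1)) =
      1 / ((2 * real m + 1) * central_prob m ^ 2) *
      ((2 * real m + 2) ^ 2 / ((2 * real m + 1) * (2 * real m + 3)))"
    using Suc * by (simp add: power2_eq_square algebra_simps)
  also have "\<dots> = 1 / ((2 * real (Suc m) + 1) * central_prob (Suc m) ^ 2)"
    using central_prob_pos[of m] by (simp add: central_prob_Suc divide_simps power2_eq_square)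
  finally show ?case .
qed

text \<open>The sequence \<open>m * central_prob m ^ 2\<close> increases to \<open>1 / pi\<close>,
  so its limit bounds every term.\<close>

lemma central_prob_le: "m > 0 \<Longrightarrow> central_prob m \<le> 1 / sqrt (pi * real m)"
proof -
  assume m: "m > 0"
  let ?W = "\<lambda>n. \<Prod>k=1..n. (4 * real k ^ 2) / (4 * real k ^ 2 - 1)"
  have "(\<lambda>n. real n / (2 * real n + 1)) \<longlonglongrightarrow> 1 / 2"
    by real_asymp
  from tendsto_divide[OF this wallis]
  have "(\<lambda>n. real n / (2 * real n + 1) / ?W n) \<longlonglongrightarrow> (1 / 2) / (pi / 2)"
    by simp
  also have "(\<lambda>n. real n / (2 * real n + 1) / ?W n) = (\<lambda>n. real n * central_prob n ^ 2)"
    by (rule ext) (simp add: wallis_product_eq del: One_nat_def)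
  finally have lim: "(\<lambda>n. real n * central_prob n ^ 2) \<longlonglongrightarrow> 1 / pi"
    by simp
  have "incseq (\<lambda>n. real n * central_prob n ^ 2)"
  proof (rule incseq_SucI)
    fix n
    have "real (Suc n) * central_prob (Suc n) ^ 2
        = central_prob n ^ 2 * ((2 * real n + 1) ^ 2 / (4 * (real n + 1)))"
      by (simp add: central_prob_Suc divide_simps power2_eq_square) (simp add: algebra_simps)
    \<comment> \<open>The two sides differ because \<open>4n(n+1) = (2n+1)^2 - 1\<close>.\<close>
    moreover have "real n \<le> (2 * real n + 1) ^ 2 / (4 * (real n + 1))"
      by (simp add: divide_simps power2_eq_square algebra_simps)
    ultimately show "real n * central_prob n ^ 2 \<le> real (Suc n) * central_prob (Suc n) ^ 2"
      by (metis mult.commute mult_right_mono zero_le_power2)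
  qed
  from incseq_le[OF this lim, of m] have "central_prob m ^ 2 \<le> 1 / (pi * real m)"
    using m by (simp add: field_simps)
  then have "sqrt (central_prob m ^ 2) \<le> sqrt (1 / (pi * real m))"
    by (rule real_sqrt_le_mono)
  then show ?thesis
    using central_prob_pos[of m] by (simp add: real_sqrt_divide)
qed

section \<open>Gaussian upper bound for binomial probabilities\<close>

lemma one_minus_le_one_plus_mult_exp:
  fixes u :: real
  assumes "u \<ge> 0"
  shows "1 - u \<le> (1 + u) * exp (- 2 * u)"
proof -
  \<comment> \<open>Multiplying the claim by \<open>exp u\<close> makes it symmetric; the derivative
    of the difference then collapses to a product of nonnegative factors, and
    \<open>f 0 = 0\<close>.\<close>
  define f where "f = (\<lambda>u::real. (1 + u) * exp (- u) - (1 - u) * exp u)"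
  have "f 0 \<le> f u"
  proof (rule DERIV_nonneg_imp_nondecreasing[OF assms])
    fix x :: real assume "0 \<le> x"
    have "(f has_real_derivative x * (exp x - exp (- x))) (at x)"
      unfolding f_def by (auto intro!: derivative_eq_intros simp: algebra_simps)
    moreover have "x * (exp x - exp (- x)) \<ge> 0"
      using \<open>0 \<le> x\<close> by simp
    ultimately show "\<exists>y. (f has_real_derivative y) (at x) \<and> 0 \<le> y" by blast
  qed
  then have "(1 - u) * exp u \<le> (1 + u) * exp (- u)"
    by (simp add: f_def)
  then have "(1 - u) * exp u * exp (- u) \<le> (1 + u) * exp (- u) * exp (- u)"
    by (rule mult_right_mono) simp
  then show ?thesis
    by (simp add: mult.assoc flip: exp_add)
qed

text \<open>The prefactor is the central density of the normal law with variance \<open>n/4\<close>.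
  The denominator \<open>n + 1\<close> in the exponent, in place of \<open>n\<close>, makes the
  ratio of consecutive values fit the exact ratio of binomial coefficients.\<close>

definition gauss_bound :: "nat \<Rightarrow> nat \<Rightarrow> real" where
  "gauss_bound n j = sqrt (2 / (pi * real n)) * exp (- 2 * (real j - real n / 2)\<^sup>2 / (real n + 1))"

lemma choose_le_gauss_bound_Suc:
  assumes "n \<le> 2 * j + 1" "j \<le> n" "real (n choose j) / 2 ^ n \<le> gauss_bound n j"
  shows "real (n choose Suc j) / 2 ^ n \<le> gauss_bound n (Suc j)"
proof -
  \<comment> \<open>This \<open>u\<close> solves
    \<open>(1 - u) / (1 + u) = (n - j) / (j + 1)\<close>, and the exponent of
    \<open>gauss_bound\<close> drops by exactly \<open>2 * u\<close> from \<open>j\<close> to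
    \<open>Suc j\<close>. Being at or beyond the centre gives \<open>u >= 0\<close>.\<close>
  define u where "u = (2 * real j + 1 - real n) / (real n + 1)"
  have u0: "u \<ge> 0"
    using assms(1) by (simp add: u_def flip: of_nat_mult)
  have "real (Suc j) * real (n choose Suc j) = real (n - j) * real (n choose j)"
    using binomial_absorption[of j n] binomial_absorb_comp[of n j]
    by (simp flip: of_nat_mult del: of_nat_Suc)
  then have "real (n choose Suc j) = (real n - real j) / (real j + 1) * real (n choose j)"
    using assms(2) by (simp add: field_simps of_nat_diff)
  also have "(real n - real j) / (real j + 1) = (1 - u) / (1 + u)"
    by (simp add: u_def divide_simps) (simp add: algebra_simps)
  also have "(1 - u) / (1 + u) \<le> exp (- 2 * u)"
    using one_minus_le_one_plus_mult_exp[OF u0] u0 by (simp add: field_simps)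
  finally have "real (n choose Suc j) / 2 ^ n \<le> exp (- 2 * u) * (real (n choose j) / 2 ^ n)"
    by (simp add: divide_right_mono mult_right_mono)
  also have "\<dots> \<le> exp (- 2 * u) * gauss_bound n j"
    using assms(3) by (intro mult_left_mono) auto
  also have "\<dots> = gauss_bound n (Suc j)"
  proof -
    have "- 2 * u + - 2 * (real j - real n / 2)\<^sup>2 / (real n + 1)
        = - 2 * (real (Suc j) - real n / 2)\<^sup>2 / (real n + 1)"
      by (simp add: u_def divide_simps power2_eq_square) (simp add: algebra_simps)
    then show ?thesis
      by (simp add: gauss_bound_def flip: exp_add)
  qed
  finally show ?thesis .
qed

text \<open>For even \<open>n\<close> the exponent vanishes and this is
  \<open>central_prob_le\<close>. For \<open>n = 2m+1\<close> the probability equals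
  \<open>central_prob (Suc m)\<close>; replacing \<open>m+1\<close> by \<open>n/2\<close> in its
  bound leaves a factor \<open>1 - 1/(2(m+1))\<close> under the root, and
  \<open>1 + x <= exp x\<close> turns it into precisely the exponent at distance 1/2 from the
  centre.\<close>

lemma choose_le_gauss_bound_mid:
  assumes "n > 0"
  shows "real (n choose ((n + 1) div 2)) / 2 ^ n \<le> gauss_bound n ((n + 1) div 2)"
proof (cases "even n")
  case True
  then obtain m where m: "n = 2 * m" by blast
  with assms have "m > 0" by simp
  from central_prob_le[OF this] m show ?thesis
    by (simp add: central_prob_def gauss_bound_def real_sqrt_divide power_mult)
next
  case False
  then obtain m where m: "n = 2 * m + 1" by (blast elim: oddE)
  have "2 * (n choose Suc m) = (2 * Suc m) choose Suc m"
    using binomial_symmetric[of m "Suc (2 * m)"] by (simp add: m Suc_diff_le)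
  then have "real ((2 * Suc m) choose Suc m) = 2 * real (n choose Suc m)"
    by (metis of_nat_mult of_nat_numeral)
  then have "real (n choose Suc m) / 2 ^ n = central_prob (Suc m)"
    unfolding central_prob_def by (simp add: m power_mult del: binomial_Suc_Suc)
  also have "\<dots> \<le> sqrt (1 / (pi * real (Suc m)))"
    using central_prob_le[of "Suc m"] by (simp add: real_sqrt_divide)
  also have "\<dots> \<le> sqrt (2 / (pi * real n) * exp (- 1 / (2 * (real m + 1))))"
  proof (rule real_sqrt_le_mono)
    have "1 / (pi * real (Suc m)) = 2 / (pi * real n) * (1 - 1 / (2 * (real m + 1)))"
      by (simp add: m divide_simps) (simp add: algebra_simps)
    also have "\<dots> \<le> 2 / (pi * real n) * exp (- 1 / (2 * (real m + 1)))"
      using exp_ge_add_one_self[of "- 1 / (2 * (real m + 1))"] by (intro mult_left_mono) auto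
    finally show "1 / (pi * real (Suc m)) \<le> 2 / (pi * real n) * exp (- 1 / (2 * (real m + 1)))" .
  qed
  also have "\<dots> = gauss_bound n (Suc m)"
  proof -
    have "sqrt (exp (- 1 / (2 * (real m + 1)))) = exp (- 1 / (4 * (real m + 1)))"
      by (rule real_sqrt_unique) (auto simp: power2_eq_square divide_simps simp flip: exp_add)
    moreover have "- 2 * (real (Suc m) - real n / 2)\<^sup>2 / (real n + 1) = - 1 / (4 * (real m + 1))"
    proof -
      have "(real (Suc m) - real n / 2)\<^sup>2 = 1 / 4" "real n + 1 = 2 * (real m + 1)"
        by (simp_all add: m power2_eq_square field_simps)
      then show ?thesis
        by (simp only:) simp
    qed
    ultimately show ?thesis
      by (simp only: gauss_bound_def real_sqrt_mult)
  qed
  finally show ?thesis by (simp add: m)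
qed

text \<open>Induction carries the bound rightwards from the middle; the symmetry
  \<open>j -> n - j\<close> of both sides gives the left half.\<close>

theorem choose_le_gauss_bound:
  assumes "n > 0"
  shows "real (n choose j) / 2 ^ n \<le> gauss_bound n j"
proof -
  have upper: "real (n choose j) / 2 ^ n \<le> gauss_bound n j" if "(n + 1) div 2 \<le> j" for j
    using that
  proof (induction j rule: dec_induct)
    case base
    show ?case by (rule choose_le_gauss_bound_mid[OF assms])
  next
    case (step j)
    show ?case
    proof (cases "j \<le> n")
      case True
      with step show ?thesis by (intro choose_le_gauss_bound_Suc) auto
    qed (simp add: gauss_bound_def binomial_eq_0)
  qed
  show ?thesis
  proof (cases "(n + 1) div 2 \<le> j")
    case False
    then have "j \<le> n" "(n + 1) div 2 \<le> n - j" by auto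
    moreover have "gauss_bound n (n - j) = gauss_bound n j"
    proof -
      have "(real (n - j) - real n / 2)\<^sup>2 = (real j - real n / 2)\<^sup>2"
        using \<open>j \<le> n\<close> by (simp add: of_nat_diff power2_eq_square algebra_simps)
      then show ?thesis by (simp add: gauss_bound_def)
    qed
    ultimately show ?thesis
      using upper[of "n - j"] binomial_symmetric[of j n] by simp
  qed (rule upper)
qed

section \<open>Moments of the binomial distribution on even numbers\<close>

lemma sum_choose_Suc:
  fixes h :: "nat \<Rightarrow> real"
  shows "(\<Sum>j\<le>Suc n. real (Suc n choose j) * h j) = (\<Sum>j\<le>n. real (n choose j) * (h j + h (Suc j)))"
proof -
  have "(\<Sum>j\<le>Suc n. real (Suc n choose j) * h j)
      = h 0 + (\<Sum>j\<le>n. real (n choose j) * h (Suc j)) + (\<Sum>j\<le>n. real (n choose Suc j) * h (Suc j))"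
    by (subst sum.atMost_Suc_shift) (simp add: algebra_simps sum.distrib)
  moreover have "h 0 + (\<Sum>j\<le>n. real (n choose Suc j) * h (Suc j)) = (\<Sum>j\<le>Suc n. real (n choose j) * h j)"
    by (subst sum.atMost_Suc_shift) simp
  ultimately show ?thesis by (simp add: algebra_simps sum.distrib)
qed

text \<open>The shift \<open>c\<close> is what makes the induction go through: by Pascal's rule one
  more toss replaces \<open>c\<close> by \<open>c - 1\<close> and \<open>c + 1\<close>, and
  \<open>(c-1)^2 + (c+1)^2 = 2(c^2 + 1)\<close>. At \<open>c = 0\<close> this is the
  variance.\<close>

lemma sum_choose_square:
  "(\<Sum>j\<le>n. real (n choose j) * (2 * real j - real n + c)\<^sup>2) = (real n + c\<^sup>2) * 2 ^ n"
proof (induction n arbitrary: c)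
  case (Suc n)
  have "(\<Sum>j\<le>Suc n. real (Suc n choose j) * (2 * real j - real (Suc n) + c)\<^sup>2)
      = (\<Sum>j\<le>n. real (n choose j) * (2 * real j - real n + (c - 1))\<^sup>2)
      + (\<Sum>j\<le>n. real (n choose j) * (2 * real j - real n + (c + 1))\<^sup>2)"
    unfolding sum_choose_Suc sum.distrib[symmetric]
    by (intro sum.cong) (simp_all add: algebra_simps)
  then show ?case
    unfolding Suc.IH by (simp add: power2_eq_square algebra_simps)
qed simp

text \<open>Up to sign this is an \<open>n\<close>-th finite difference of a quadratic polynomial,
  hence zero once \<open>n\<close> exceeds the degree.\<close>

lemma alternating_sum_choose_square:
  assumes "n \<ge> 3"
  shows "(\<Sum>j\<le>n. real (n choose j) * ((-1) ^ j * (2 * real j - real n + c)\<^sup>2)) = 0"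
  using assms
proof (induction n arbitrary: c rule: dec_induct)
  case base
  show ?case by (simp add: eval_nat_numeral) (simp add: algebra_simps)
next
  case (step n)
  have "(\<Sum>j\<le>Suc n. real (Suc n choose j) * ((-1) ^ j * (2 * real j - real (Suc n) + c)\<^sup>2))
      = (\<Sum>j\<le>n. real (n choose j) * ((-1) ^ j * (2 * real j - real n + (c - 1))\<^sup>2))
      - (\<Sum>j\<le>n. real (n choose j) * ((-1) ^ j * (2 * real j - real n + (c + 1))\<^sup>2))"
    unfolding sum_choose_Suc sum_subtractf[symmetric]
    by (intro sum.cong) (simp_all add: algebra_simps)
  then show ?case
    unfolding step.IH by simp
qed

text \<open>The weight \<open>1 + (-1)^j\<close> is 2 at even \<open>j\<close> and 0 at odd
  \<open>j\<close>; terms with \<open>2 * k > n\<close> vanish by assumption.\<close>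

lemma sum_double_index:
  fixes g :: "nat \<Rightarrow> real"
  assumes "\<And>j. j > n \<Longrightarrow> g j = 0"
  shows "2 * (\<Sum>k\<le>n. g (2 * k)) = (\<Sum>j\<le>n. g j) + (\<Sum>j\<le>n. (-1) ^ j * g j)"
proof -
  have "(\<Sum>k\<le>n. g (2 * k)) = (\<Sum>j\<in>(\<lambda>k. 2 * k) ` {..n}. g j)"
    by (simp add: sum.reindex inj_on_def)
  also have "\<dots> = (\<Sum>j\<in>{j. j \<le> n \<and> even j}. g j)"
    by (rule sum.mono_neutral_right) (auto simp: image_iff elim!: evenE intro!: assms)
  also have "\<dots> = (\<Sum>j\<le>n. if even j then g j else 0)"
    by (subst sum.inter_filter[symmetric]) (auto intro!: sum.cong)
  also have "2 * \<dots> = (\<Sum>j\<le>n. g j) + (\<Sum>j\<le>n. (-1) ^ j * g j)"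
    unfolding sum_distrib_left sum.distrib[symmetric] by (intro sum.cong) auto
  finally show ?thesis .
qed

lemma sum_choose_double:
  assumes "n > 0"
  shows "(\<Sum>k\<le>n. real (n choose (2 * k))) = 2 ^ (n - 1)"
proof -
  have "2 * (\<Sum>k\<le>n. real (n choose (2 * k))) = 2 ^ n"
    using sum_double_index[of n "\<lambda>j. real (n choose j)"] assms
      choose_alternating_sum[of n, where 'a = real] choose_row_sum[of n]
    by (simp flip: of_nat_sum)
  then show ?thesis using assms by (cases n) auto
qed

text \<open>Restricting to even indices halves the full second moment, as the alternating part
  vanishes; this is where \<open>n >= 3\<close> enters the moment computation.\<close>

lemma sum_choose_double_square:
  assumes "n \<ge> 3"
  shows "(\<Sum>k\<le>n. real (n choose (2 * k)) * (real (2 * k) - real n / 2)\<^sup>2) = 2 ^ (n - 1) * real n / 4"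
proof -
  have "2 * (\<Sum>k\<le>n. real (n choose (2 * k)) * (2 * real (2 * k) - real n)\<^sup>2) = real n * 2 ^ n"
    using sum_double_index[of n "\<lambda>j. real (n choose j) * (2 * real j - real n)\<^sup>2"]
      alternating_sum_choose_square[OF assms, of 0] sum_choose_square[of n 0]
    by (simp add: mult_ac)
  moreover have "2 * (\<Sum>k\<le>n. real (n choose (2 * k)) * (2 * real (2 * k) - real n)\<^sup>2)
      = 8 * (\<Sum>k\<le>n. real (n choose (2 * k)) * (real (2 * k) - real n / 2)\<^sup>2)"
    unfolding sum_distrib_left by (intro sum.cong) (simp_all add: power2_eq_square algebra_simps)
  moreover have "(2::real) ^ n = 2 * 2 ^ (n - 1)"
    using assms by (cases n) auto
  ultimately show ?thesis by (simp add: mult_ac)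
qed

section \<open>Ascents and changes of cyclic binary words\<close>

lemma bij_betw_Suc_mod:
  assumes "n > 0"
  shows "bij_betw (\<lambda>i. Suc i mod n) {..<n} {..<n}"
proof -
  have "inj_on (\<lambda>i. Suc i mod n) {..<n}"
    by (rule inj_onI) (auto simp: mod_Suc split: if_splits)
  moreover have "(\<lambda>i. Suc i mod n) ` {..<n} \<subseteq> {..<n}"
    using assms by auto
  ultimately show ?thesis
    by (simp add: bij_betw_def endo_inj_surj)
qed

text \<open>The increments of \<open>b\<close> around the cycle sum to 0. They are +1 at ascents and
  -1 at descents, so the two are equally many and together form the changes.\<close>

lemma card_cyclic_changes:
  fixes b :: "nat \<Rightarrow> bool"
  assumes "n > 0"
  shows "card {i. i < n \<and> b i \<noteq> b (Suc i mod n)}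
    = 2 * card {i. i < n \<and> \<not> b i \<and> b (Suc i mod n)}"
proof -
  let ?s = "\<lambda>i. Suc i mod n"
  let ?up = "{i. i < n \<and> \<not> b i \<and> b (?s i)}" and ?down = "{i. i < n \<and> b i \<and> \<not> b (?s i)}"
  have "(\<Sum>i<n. of_bool (b (?s i))) = (\<Sum>i<n. of_bool (b i) :: int)"
    using sum.reindex_bij_betw[OF bij_betw_Suc_mod[OF assms], of "\<lambda>i. of_bool (b i) :: int"] .
  then have "0 = (\<Sum>i<n. of_bool (b (?s i)) - of_bool (b i) :: int)"
    by (simp add: sum_subtractf)
  also have "\<dots> = (\<Sum>i<n. of_bool (i \<in> ?up) - of_bool (i \<in> ?down))"
    by (intro sum.cong) auto
  also have "\<dots> = int (card ?up) - int (card ?down)"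
    by (simp add: sum_subtractf Int_def of_bool_def sum.If_cases)
  finally have "card ?up = card ?down" by simp
  moreover have "card (?up \<union> ?down) = card ?up + card ?down"
    by (rule card_Un_disjoint) auto
  moreover have "{i. i < n \<and> b i \<noteq> b (?s i)} = ?up \<union> ?down" by auto
  ultimately show ?thesis by simp
qed

lemma cyclic_changes_determine:
  fixes b c :: "nat \<Rightarrow> bool"
  assumes "b 0 = c 0"
    and "{i. i < n \<and> b i \<noteq> b (Suc i mod n)} = {i. i < n \<and> c i \<noteq> c (Suc i mod n)}"
    and "i < n"
  shows "b i = c i"
  using \<open>i < n\<close>
proof (induction i)
  case (Suc i)
  have "b i \<noteq> b (Suc i) \<longleftrightarrow> c i \<noteq> c (Suc i)"
  proof -
    have "i < n \<and> b i \<noteq> b (Suc i mod n) \<longleftrightarrow> i < n \<and> c i \<noteq> c (Suc i mod n)"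
      using assms(2) by blast
    \<comment> \<open>Since \<open>Suc i < n\<close>, the reduction modulo \<open>n\<close> has no
      effect here.\<close>
    then show ?thesis using Suc.prems by simp
  qed
  with Suc show ?case by auto
qed (rule assms(1))

section \<open>Orientations of the cycle and the law of the number of hit vertices\<close>

locale cyclic_orientation =
  fixes n :: nat and v :: "nat \<Rightarrow> 'a" and V :: "'a set" and E :: "'a set set"
  assumes n_ge: "n \<ge> 3"
    and bij_v: "bij_betw v {..<n} V"
    and E_eq: "E = {{v i, v ((i + 1) mod n)} | i. i < n}"
begin

abbreviation succ :: "nat \<Rightarrow> nat" where
  "succ i \<equiv> Suc i mod n"

definition edge :: "nat \<Rightarrow> 'a set" where
  "edge i = {v i, v (succ i)}"

text \<open>Fixing the value \<open>undefined\<close> outside \<open>E\<close>, as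
  \<open>Pi_pmf\<close> does, makes \<open>random_orientation E\<close> uniform on this finite
  set.\<close>

definition orientations :: "('a set \<Rightarrow> 'a) set" where
  "orientations = PiE_dflt E undefined (\<lambda>e. e)"

definition forward :: "('a set \<Rightarrow> 'a) \<Rightarrow> nat \<Rightarrow> bool" where
  "forward \<omega> i \<longleftrightarrow> \<omega> (edge i) = v (succ i)"

lemma n_pos: "n > 0"
  using n_ge by simp

lemma succ_less: "succ i < n"
  using n_pos by simp

lemma v_eq_iff: "i < n \<Longrightarrow> j < n \<Longrightarrow> v i = v j \<longleftrightarrow> i = j"
  using bij_v by (auto simp: bij_betw_def inj_on_eq_iff)

lemma succ_neq: "i < n \<Longrightarrow> succ i \<noteq> i"
  using n_ge by (auto simp: mod_Suc)

lemma succ_eq_iff: "i < n \<Longrightarrow> j < n \<Longrightarrow> succ i = succ j \<longleftrightarrow> i = j"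
  using inj_onD[OF bij_betw_imp_inj_on[OF bij_betw_Suc_mod[OF n_pos]], of i j] by auto

lemma E_eq_image: "E = edge ` {..<n}"
  by (auto simp: E_eq edge_def)

lemma inj_edge: "inj_on edge {..<n}"
proof (rule inj_onI)
  fix i j assume ij: "i \<in> {..<n}" "j \<in> {..<n}" "edge i = edge j"
  show "i = j"
  proof (rule ccontr)
    assume "i \<noteq> j"
    \<comment> \<open>Distinct indices with the same edge would have to succeed each other, which
      requires a cycle of length at most 2.\<close>
    with ij have "i = succ j" "j = succ i"
      by (auto simp: edge_def doubleton_eq_iff v_eq_iff succ_less)
    moreover have "i < n" "j < n" using ij by auto
    moreover have "succ k = (if Suc k = n then 0 else Suc k)" if "k < n" for k
      using that by (simp add: mod_Suc)
    ultimately have "Suc j = n \<and> i = 0 \<or> i = Suc j" "Suc i = n \<and> j = 0 \<or> j = Suc i"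
      by metis+
    then show False
      using n_ge by linarith
  qed
qed

lemma finite_E: "finite E"
  by (simp add: E_eq_image)

lemma card_edge: "i < n \<Longrightarrow> card (edge i) = 2"
  using succ_neq[of i] succ_less[of i] by (auto simp: edge_def card_2_iff v_eq_iff)

lemma edge_finite: "e \<in> E \<Longrightarrow> finite e" and edge_nonempty: "e \<in> E \<Longrightarrow> e \<noteq> {}"
  by (auto simp: E_eq_image edge_def)

lemma random_orientation_eq: "random_orientation E = pmf_of_set orientations"
  unfolding random_orientation_def orientations_def
  using Pi_pmf_of_set[of E "\<lambda>e. e" undefined] finite_E edge_finite edge_nonempty by auto

lemma finite_orientations: "finite orientations"
  unfolding orientations_def using finite_E edge_finite by (rule finite_PiE_dflt)

lemma card_orientations: "card orientations = 2 ^ n"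
proof -
  have "card orientations = (\<Prod>e\<in>E. card e)"
    unfolding orientations_def using finite_E edge_finite by (rule card_PiE_dflt)
  also have "\<dots> = (\<Prod>i<n. card (edge i))"
    by (simp add: E_eq_image prod.reindex[OF inj_edge])
  also have "\<dots> = 2 ^ n"
    by (simp add: card_edge)
  finally show ?thesis .
qed

lemma orientations_nonempty: "orientations \<noteq> {}"
  using card_orientations by force

lemma orientation_edge:
  assumes "\<omega> \<in> orientations" "i < n"
  shows "\<omega> (edge i) = (if forward \<omega> i then v (succ i) else v i)"
proof -
  have "edge i \<in> E"
    using assms(2) by (simp add: E_eq_image)
  with assms(1) have "\<omega> (edge i) \<in> edge i"
    by (simp add: orientations_def PiE_dflt_def)
  then show ?thesis by (auto simp: forward_def edge_def)
qed

text \<open>Only the edges \<open>i\<close> and \<open>succ i\<close> meet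
  \<open>v (succ i)\<close>. It is missed when the first points back to \<open>v i\<close> and the
  second points onwards, that is, at an ascent of the word \<open>forward\<close>.\<close>

lemma in_degree_eq_0_iff:
  assumes "\<omega> \<in> orientations" "i < n"
  shows "in_degree E \<omega> (v (succ i)) = 0 \<longleftrightarrow> \<not> forward \<omega> i \<and> forward \<omega> (succ i)"
proof -
  have "in_degree E \<omega> (v (succ i)) = 0 \<longleftrightarrow> (\<forall>j<n. \<omega> (edge j) \<noteq> v (succ i))"
    using finite_E by (auto simp: in_degree_def E_eq_image)
  also have "\<dots> \<longleftrightarrow> (\<forall>j<n. \<not> (j = i \<and> forward \<omega> j) \<and> \<not> (j = succ i \<and> \<not> forward \<omega> j))"
    using assms by (auto simp: orientation_edge v_eq_iff succ_less succ_eq_iff)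
  also have "\<dots> \<longleftrightarrow> \<not> forward \<omega> i \<and> forward \<omega> (succ i)"
    using assms(2) succ_less[of i] by blast
  finally show ?thesis .
qed

lemma num_nonzero_le: "num_nonzero_in_degree V E \<omega> \<le> n"
proof -
  have "finite V" "card V = n"
    using bij_betw_finite[OF bij_v] bij_betw_same_card[OF bij_v] by auto
  then show ?thesis
    using card_mono[of V "{w \<in> V. in_degree E \<omega> w \<noteq> 0}"]
    by (simp add: num_nonzero_in_degree_def)
qed

lemma num_nonzero_eq:
  assumes "\<omega> \<in> orientations"
  shows "num_nonzero_in_degree V E \<omega> + card {i. i < n \<and> \<not> forward \<omega> i \<and> forward \<omega> (succ i)} = n"
proof -
  let ?Z = "{i. i < n \<and> \<not> forward \<omega> i \<and> forward \<omega> (succ i)}"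
  have bij: "bij_betw (\<lambda>i. v (succ i)) {..<n} V"
    using bij_betw_trans[OF bij_betw_Suc_mod[OF n_pos] bij_v] by (simp add: comp_def)
  have "{w \<in> V. in_degree E \<omega> w \<noteq> 0}
      = (\<lambda>i. v (succ i)) ` {i \<in> {..<n}. in_degree E \<omega> (v (succ i)) \<noteq> 0}"
    unfolding bij_betw_imp_surj_on[OF bij, symmetric] by blast
  also have "{i \<in> {..<n}. in_degree E \<omega> (v (succ i)) \<noteq> 0} = {..<n} - ?Z"
    by (intro set_eqI) (simp add: in_degree_eq_0_iff[OF assms] del: neq0_conv cong: conj_cong)
  finally have "num_nonzero_in_degree V E \<omega> = card ({..<n} - ?Z)"
    using bij_betw_imp_inj_on[OF bij]
    by (simp add: num_nonzero_in_degree_def card_image inj_on_diff)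
  also have "\<dots> = n - card ?Z"
    by (subst card_Diff_subset) auto
  finally have "num_nonzero_in_degree V E \<omega> = n - card ?Z" .
  moreover have "card ?Z \<le> n"
    by (rule subset_eq_atLeast0_lessThan_card) auto
  ultimately show ?thesis by simp
qed

text \<open>With \<open>k\<close> missed vertices there are \<open>k\<close> ascents, hence
  \<open>2 * k\<close> changes. The first letter and the set of changes determine the orientation,
  so injectivity of this encoding gives the bound; equality follows later from total mass, without
  proving surjectivity.\<close>

lemma card_orientations_le:
  assumes "k \<le> n"
  shows "card {\<omega> \<in> orientations. num_nonzero_in_degree V E \<omega> = n - k} \<le> 2 * (n choose (2 * k))"
proof -
  let ?A = "{\<omega> \<in> orientations. num_nonzero_in_degree V E \<omega> = n - k}"
  let ?B = "UNIV \<times> {D. D \<subseteq> {..<n} \<and> card D = 2 * k} :: (bool \<times> nat set) set"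
  let ?D = "\<lambda>\<omega>. {i. i < n \<and> forward \<omega> i \<noteq> forward \<omega> (succ i)}"
  have "inj_on (\<lambda>\<omega>. (forward \<omega> 0, ?D \<omega>)) ?A"
  proof (rule inj_onI)
    fix \<omega> \<omega>' assume "\<omega> \<in> ?A" "\<omega>' \<in> ?A" "(forward \<omega> 0, ?D \<omega>) = (forward \<omega>' 0, ?D \<omega>')"
    then have orient: "\<omega> \<in> orientations" "\<omega>' \<in> orientations"
      and start: "forward \<omega> 0 = forward \<omega>' 0" and changes: "?D \<omega> = ?D \<omega>'"
      by (simp_all only: prod.inject mem_Collect_eq)
    show "\<omega> = \<omega>'"
    proof
      fix e
      show "\<omega> e = \<omega>' e"
      proof (cases "e \<in> E")
        case True
        then obtain i where i: "i < n" "e = edge i" by (auto simp: E_eq_image)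
        from start changes i(1) have "forward \<omega> i = forward \<omega>' i"
          by (rule cyclic_changes_determine)
        then show ?thesis using orient i by (simp add: orientation_edge)
      next
        case False
        with orient show ?thesis by (auto simp: orientations_def PiE_dflt_def)
      qed
    qed
  qed
  moreover have "(\<lambda>\<omega>. (forward \<omega> 0, ?D \<omega>)) ` ?A \<subseteq> ?B"
  proof
    fix x assume "x \<in> (\<lambda>\<omega>. (forward \<omega> 0, ?D \<omega>)) ` ?A"
    then obtain \<omega> where \<omega>: "\<omega> \<in> ?A" "x = (forward \<omega> 0, ?D \<omega>)" by blast
    then have "card {i. i < n \<and> \<not> forward \<omega> i \<and> forward \<omega> (succ i)} = k"
      using num_nonzero_eq[of \<omega>] assms by auto
    then have "card (?D \<omega>) = 2 * k"
      using card_cyclic_changes[OF n_pos, of "forward \<omega>"] by simp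
    with \<omega> show "x \<in> ?B" by auto
  qed
  moreover have "finite ?B"
    by (intro finite_cartesian_product) auto
  ultimately have "card ?A \<le> card ?B"
    by (rule card_inj_on_le)
  also have "card ?B = 2 * (n choose (2 * k))"
    by (simp add: card_cartesian_product n_subsets)
  finally show ?thesis .
qed

lemma prob_le:
  assumes "k \<le> n"
  shows "measure_pmf.prob (random_orientation E) {\<omega>. num_nonzero_in_degree V E \<omega> = n - k}
    \<le> real (n choose (2 * k)) / 2 ^ (n - 1)"
proof -
  have "measure_pmf.prob (random_orientation E) {\<omega>. num_nonzero_in_degree V E \<omega> = n - k}
      = real (card {\<omega> \<in> orientations. num_nonzero_in_degree V E \<omega> = n - k}) / 2 ^ n"
    using finite_orientations orientations_nonempty
    by (simp add: random_orientation_eq measure_pmf_of_set card_orientations Int_def)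
  also have "\<dots> \<le> real (2 * (n choose (2 * k))) / 2 ^ n"
    using card_orientations_le[OF assms] by (intro divide_right_mono of_nat_mono) auto
  also have "\<dots> = real (n choose (2 * k)) / 2 ^ (n - 1)"
    using n_pos by (cases n) auto
  finally show ?thesis .
qed

text \<open>The probabilities and their upper bounds from \<open>prob_le\<close> both sum to 1 over
  \<open>k <= n\<close>, so no single inequality can be strict.\<close>

lemma prob_eq:
  assumes "k \<le> n"
  shows "measure_pmf.prob (random_orientation E) {\<omega>. num_nonzero_in_degree V E \<omega> = n - k}
    = real (n choose (2 * k)) / 2 ^ (n - 1)"
proof -
  let ?X = "num_nonzero_in_degree V E"
  let ?P = "\<lambda>s. measure_pmf.prob (random_orientation E) {\<omega>. ?X \<omega> = s}"
  have "(\<Sum>k\<le>n. ?P (n - k)) = (\<Sum>s\<le>n. ?P s)"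
    by (rule sum.reindex_bij_witness[of _ "\<lambda>s. n - s" "\<lambda>k. n - k"]) auto
  also have "\<dots> = (\<Sum>s\<le>n. pmf (map_pmf ?X (random_orientation E)) s)"
    by (simp add: pmf_map vimage_def)
  also have "\<dots> = 1"
    using num_nonzero_le by (intro sum_pmf_eq_1) auto
  also have "1 = (\<Sum>k\<le>n. real (n choose (2 * k)) / 2 ^ (n - 1))"
    using n_pos by (simp add: sum_choose_double flip: sum_divide_distrib)
  finally show ?thesis
    by (rule sum_mono_inv) (use assms prob_le in auto)
qed

lemma entropy_eq:
  "shannon_entropy (random_orientation E) {0..n} (num_nonzero_in_degree V E) =
    - (\<Sum>k\<le>n. real (n choose (2 * k)) / 2 ^ (n - 1) * log 2 (real (n choose (2 * k)) / 2 ^ (n - 1)))"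
proof -
  let ?X = "num_nonzero_in_degree V E"
  let ?P = "\<lambda>s. measure_pmf.prob (random_orientation E) {\<omega>. ?X \<omega> = s}"
  have "shannon_entropy (random_orientation E) {0..n} ?X = - (\<Sum>s\<in>{0..n}. ?P s * log 2 (?P s))"
    using num_nonzero_le by (intro shannon_entropy_eq_sum) auto
  also have "(\<Sum>s\<in>{0..n}. ?P s * log 2 (?P s)) = (\<Sum>k\<le>n. ?P (n - k) * log 2 (?P (n - k)))"
    by (rule sum.reindex_bij_witness[of _ "\<lambda>s. n - s" "\<lambda>k. n - k"]) auto
  finally show ?thesis by (simp add: prob_eq)
qed

end

section \<open>The entropy estimate\<close>

lemma entropy_even_binomial_ge:
  assumes "n \<ge> 3"
  defines "r \<equiv> \<lambda>k. real (n choose (2 * k)) / 2 ^ (n - 1)"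
  shows "- (\<Sum>k\<le>n. r k * log 2 (r k))
    \<ge> 1/2 * log 2 (real n) + 1/2 * log 2 pi - 3/2 + real n / (2 * ln 2 * (real n + 1))"
proof -
  \<comment> \<open>Here \<open>c\<close> is the binary logarithm of twice the prefactor of
    \<open>gauss_bound\<close>, the 2 coming from the restriction to even numbers, and
    \<open>d\<close> is the coefficient of its exponent converted to base 2.\<close>
  define c where "c = 3/2 - 1/2 * log 2 pi - 1/2 * log 2 (real n)"
  define d where "d = 2 / (ln 2 * (real n + 1))"
  have n: "n > 0" using assms by simp
  have ln2_pos: "ln (2::real) > 0" by simp
  have *: "r k * log 2 (r k) \<le> r k * (c - d * (real (2 * k) - real n / 2)\<^sup>2)" for k
  proof (cases "n choose (2 * k) = 0")
    case False
    then have r_pos: "r k > 0" by (simp add: r_def)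
    have "r k = 2 * (real (n choose (2 * k)) / 2 ^ n)"
      using n by (cases n) (auto simp: r_def)
    also have "\<dots> \<le> 2 * gauss_bound n (2 * k)"
      using choose_le_gauss_bound[OF n] by (intro mult_left_mono) auto
    finally have "ln (r k) \<le> ln (2 * gauss_bound n (2 * k))"
      using r_pos by simp
    also have "\<dots> = ln 2 + (ln 2 - ln pi - ln (real n)) / 2
        - 2 * (real (2 * k) - real n / 2)\<^sup>2 / (real n + 1)"
      using n by (simp add: gauss_bound_def ln_mult ln_div ln_sqrt)
    also have "\<dots> = ln 2 * (c - d * (real (2 * k) - real n / 2)\<^sup>2)"
    proof -
      have "ln 2 * c = ln 2 + (ln 2 - ln pi - ln (real n)) / 2"
        by (simp add: c_def log_def field_simps)
      moreover have "ln 2 * d = 2 / (real n + 1)"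
        by (simp add: d_def)
      ultimately show ?thesis
        unfolding right_diff_distrib mult.assoc[symmetric] by simp
    qed
    finally have "log 2 (r k) \<le> c - d * (real (2 * k) - real n / 2)\<^sup>2"
      using ln2_pos by (simp add: log_def field_simps)
    then show ?thesis
      using r_pos by (intro mult_left_mono) auto
  next
    case True
    then have "r k = 0" by (simp add: r_def del: binomial_eq_0_iff)
    then show ?thesis by simp
  qed
  have sum_r: "(\<Sum>k\<le>n. r k) = 1"
    using n by (simp add: r_def sum_choose_double flip: sum_divide_distrib)
  have sum_sq: "(\<Sum>k\<le>n. r k * (real (2 * k) - real n / 2)\<^sup>2) = real n / 4"
    using sum_choose_double_square[OF assms(1)]
    unfolding r_def times_divide_eq_left sum_divide_distrib[symmetric] by simp
  have "(\<Sum>k\<le>n. r k * log 2 (r k)) \<le> (\<Sum>k\<le>n. r k * (c - d * (real (2 * k) - real n / 2)\<^sup>2))"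
    by (intro sum_mono *)
  also have "\<dots> = c * (\<Sum>k\<le>n. r k) - d * (\<Sum>k\<le>n. r k * (real (2 * k) - real n / 2)\<^sup>2)"
    by (simp add: sum_distrib_left sum_subtractf algebra_simps)
  \<comment> \<open>The mean squared deviation is \<open>n/4\<close>, so the quadratic term
    contributes \<open>d * n / 4\<close>.\<close>
  also have "\<dots> = c - real n / (2 * ln 2 * (real n + 1))"
    unfolding sum_r sum_sq by (simp add: d_def)
  finally show ?thesis by (simp add: c_def)
qed

theorem theorem1p5:
  fixes n :: nat and V :: "'a set" and E :: "'a set set"
  assumes "n \<ge> 3"
    and "is_cycle_graph n V E"
  shows "shannon_entropy (random_orientation E) {0..n} (num_nonzero_in_degree V E)
    \<ge> 1/2 * log 2 (real n) + 1/2 * log 2 (pi * exp 1) - 3/2 - 1 / (2 * ln 2 * (real n - 1))"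
proof -
  from assms obtain v where "bij_betw v {..<n} V" "E = {{v i, v ((i + 1) mod n)} | i. i < n}"
    unfolding is_cycle_graph_def by blast
  with assms(1) interpret cyclic_orientation n v V E
    by unfold_locales
  have "1/2 * log 2 (pi * exp 1) = 1/2 * log 2 pi + 1 / (2 * ln 2)"
    by (simp add: log_def ln_mult add_divide_distrib)
  \<comment> \<open>The term \<open>1 / (2 * ln 2)\<close> is the share of \<open>exp 1\<close> in
    the logarithm. As \<open>n/(n+1) = 1 - 1/(n+1)\<close>, the loss actually incurred has
    \<open>n + 1\<close> where the claim allows \<open>n - 1\<close>.\<close>
  moreover have "1 / (2 * ln 2) - 1 / (2 * ln 2 * (real n - 1)) \<le> real n / (2 * ln 2 * (real n + 1))"
  proof -
    have "1 - 1 / (real n - 1) \<le> real n / (real n + 1)"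
      using assms(1) by (simp add: divide_simps) (simp add: algebra_simps)
    then have "(1 - 1 / (real n - 1)) / (2 * ln 2) \<le> real n / (real n + 1) / (2 * ln 2)"
      by (rule divide_right_mono) simp
    then show ?thesis
      by (simp add: diff_divide_distrib mult.commute)
  qed
  ultimately show ?thesis
    using entropy_even_binomial_ge[OF assms(1)] unfolding entropy_eq by linarith
qed

end
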